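(* Let $P$ be a connected finite $\Gamma$-colored minuscule poset and assume $\Gamma$ is simply laced. If $P$ is a chain, then $P$ has type $A$ standard, i.e. $P$ is isomorphic, as a colored poset, to an $n$-element chain colored from top to bottom by $c_1,c_2,\dots,c_n$, where the Dynkin diagram is the simply laced path $c_1\sim c_2\sim\cdots\sim c_n$ (with all non-consecutive pairs distant), for some $n\ge1$.
   Context: A Dynkin diagram $\Gamma$: finite set of colors with integers $\theta_{ab}$, $\theta_{aa}=2$, $\theta_{ab}\le0$ ($a\ne b$), $\theta_{ab}=0\iff\theta_{ba}=0$; $a\sim b$ if $a\ne b$ and $\theta_{ab}<0$; simply laced if all $\theta_{ab}\in\{-1,0,2\}$. $\Gamma$-colored poset: poset $P$ with surjective $\kappa:P\to\Gamma$; isomorphism: poset isomorphism $\pi$ and $\theta$-preserving bijection $\gamma$ of diagrams with $\kappa_2\pi=\gamma\kappa_1$. Consecutive elements of color $a$: $x<y$ of color $a$, no color-$a$ element in $(x,y)$. $U(x,P)=\{y>x:\kappa(y)\sim\kappa(x)\}$, $L(x,P)=\{y<x:\kappa(y)\sim\kappa(x)\}$. $P$ is $\Gamma$-colored minuscule if locally finite and: (EC) equal colors comparable; (NA) neighbors (one covers the other) have adjacent colors; (AC) adjacent colors comparable; (ICE2) consecutive $x<y$ of color $a$ satisfy $\sum_{z\in(x,y)}-\theta_{\kappa(z),a}=2$; (UCB1) for maximal $x$ of color $a$, $U(x,P)$ finite and $\sum_{y\in U(x,P)}-\theta_{\kappa(y),a}\le1$; (LCB1) for minimal $x$ of color $a$,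 $L(x,P)$ finite and $\sum_{y\in L(x,P)}-\theta_{\kappa(y),a}\le1$. *)

theory Defs
  imports Main
begin

record 'c dynkin =
  colors :: "'c set"
  theta :: "'c \<Rightarrow> 'c \<Rightarrow> int"

definition dynkin_diagram :: "'c dynkin \<Rightarrow> bool" where
  "dynkin_diagram G \<longleftrightarrow>
     finite (colors G) \<and>
     (\<forall>a\<in>colors G. theta G a a = 2) \<and>
     (\<forall>a\<in>colors G. \<forall>b\<in>colors G. a \<noteq> b \<longrightarrow>
        theta G a b \<le> 0 \<and> (theta G a b = 0 \<longleftrightarrow> theta G b a = 0))"

definition adjacent :: "'c dynkin \<Rightarrow> 'c \<Rightarrow> 'c \<Rightarrow> bool" where
  "adjacent G a b \<longleftrightarrow> a \<noteq> b \<and> theta G a b < 0"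

definition simply_laced :: "'c dynkin \<Rightarrow> bool" where
  "simply_laced G \<longleftrightarrow> (\<forall>a\<in>colors G. \<forall>b\<in>colors G. theta G a b \<in> {-1, 0, 2})"

record ('p, 'c) colored_poset =
  elements :: "'p set"
  le :: "'p rel"
  color :: "'p \<Rightarrow> 'c"
  diagram :: "'c dynkin"

(* The reflexive order relation is required to live on the carrier. *)
definition is_colored_poset :: "('p, 'c) colored_poset \<Rightarrow> bool" where
  "is_colored_poset P \<longleftrightarrow>
     le P \<subseteq> elements P \<times> elements P \<and>
     partial_order_on (elements P) (le P) \<and>
     dynkin_diagram (diagram P) \<and>
     color P ` elements P = colors (diagram P)"

definition lt :: "('p, 'c) colored_poset \<Rightarrow> 'p \<Rightarrow> 'p \<Rightarrow> bool" where
  "lt P x y \<longleftrightarrow> (x, y) \<in> le P \<and> x \<noteq> y"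

definition comparable :: "('p, 'c) colored_poset \<Rightarrow> 'p \<Rightarrow> 'p \<Rightarrow> bool" where
  "comparable P x y \<longleftrightarrow> (x, y) \<in> le P \<or> (y, x) \<in> le P"

definition open_interval :: "('p, 'c) colored_poset \<Rightarrow> 'p \<Rightarrow> 'p \<Rightarrow> 'p set" where
  "open_interval P x y = {z \<in> elements P. lt P x z \<and> lt P z y}"

definition closed_interval :: "('p, 'c) colored_poset \<Rightarrow> 'p \<Rightarrow> 'p \<Rightarrow> 'p set" where
  "closed_interval P x y = {z \<in> elements P. (x, z) \<in> le P \<and> (z, y) \<in> le P}"

definition covers :: "('p, 'c) colored_poset \<Rightarrow> 'p \<Rightarrow> 'p \<Rightarrow> bool" where
  "covers P y x \<longleftrightarrow> lt P x y \<and> open_interval P x y = {}"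

definition neighbors :: "('p, 'c) colored_poset \<Rightarrow> 'p \<Rightarrow> 'p \<Rightarrow> bool" where
  "neighbors P x y \<longleftrightarrow> covers P x y \<or> covers P y x"

definition locally_finite :: "('p, 'c) colored_poset \<Rightarrow> bool" where
  "locally_finite P \<longleftrightarrow>
     (\<forall>x\<in>elements P. \<forall>y\<in>elements P. finite (closed_interval P x y))"

(* The Hasse diagram is a connected graph; as usual, the empty graph is not connected. *)
definition connected_poset :: "('p, 'c) colored_poset \<Rightarrow> bool" where
  "connected_poset P \<longleftrightarrow>
     elements P \<noteq> {} \<and>
     (\<forall>x\<in>elements P. \<forall>y\<in>elements P. (neighbors P)\<^sup>*\<^sup>* x y)"

definition color_class :: "('p, 'c) colored_poset \<Rightarrow> 'c \<Rightarrow> 'p set" where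
  "color_class P a = {x \<in> elements P. color P x = a}"

definition consecutive :: "('p, 'c) colored_poset \<Rightarrow> 'c \<Rightarrow> 'p \<Rightarrow> 'p \<Rightarrow> bool" where
  "consecutive P a x y \<longleftrightarrow>
     x \<in> color_class P a \<and> y \<in> color_class P a \<and> lt P x y \<and>
     open_interval P x y \<inter> color_class P a = {}"

(* x is a maximal element of the set of elements of color a, not necessarily of the poset. *)
definition maximal_in_color :: "('p, 'c) colored_poset \<Rightarrow> 'c \<Rightarrow> 'p \<Rightarrow> bool" where
  "maximal_in_color P a x \<longleftrightarrow>
     x \<in> color_class P a \<and> (\<forall>y\<in>color_class P a. \<not> lt P x y)"

definition minimal_in_color :: "('p, 'c) colored_poset \<Rightarrow> 'c \<Rightarrow> 'p \<Rightarrow> bool" where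
  "minimal_in_color P a x \<longleftrightarrow>
     x \<in> color_class P a \<and> (\<forall>y\<in>color_class P a. \<not> lt P y x)"

definition upper_adjacent :: "('p, 'c) colored_poset \<Rightarrow> 'p \<Rightarrow> 'p set" where
  "upper_adjacent P x =
     {y \<in> elements P. lt P x y \<and> adjacent (diagram P) (color P y) (color P x)}"

definition lower_adjacent :: "('p, 'c) colored_poset \<Rightarrow> 'p \<Rightarrow> 'p set" where
  "lower_adjacent P x =
     {y \<in> elements P. lt P y x \<and> adjacent (diagram P) (color P y) (color P x)}"

definition EC :: "('p, 'c) colored_poset \<Rightarrow> bool" where
  "EC P \<longleftrightarrow> (\<forall>x\<in>elements P. \<forall>y\<in>elements P. color P x = color P y \<longrightarrow> comparable P x y)"

definition NA :: "('p, 'c) colored_poset \<Rightarrow> bool" where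
  "NA P \<longleftrightarrow> (\<forall>x\<in>elements P. \<forall>y\<in>elements P. neighbors P x y \<longrightarrow>
     adjacent (diagram P) (color P x) (color P y))"

definition AC :: "('p, 'c) colored_poset \<Rightarrow> bool" where
  "AC P \<longleftrightarrow> (\<forall>x\<in>elements P. \<forall>y\<in>elements P.
     adjacent (diagram P) (color P x) (color P y) \<longrightarrow> comparable P x y)"

definition ICE2 :: "('p, 'c) colored_poset \<Rightarrow> bool" where
  "ICE2 P \<longleftrightarrow> (\<forall>a\<in>colors (diagram P). \<forall>x y. consecutive P a x y \<longrightarrow>
     (\<Sum>z\<in>open_interval P x y. - theta (diagram P) (color P z) a) = 2)"

definition UCB1 :: "('p, 'c) colored_poset \<Rightarrow> bool" where
  "UCB1 P \<longleftrightarrow> (\<forall>a\<in>colors (diagram P). \<forall>x. maximal_in_color P a x \<longrightarrow>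
     finite (upper_adjacent P x) \<and>
     (\<Sum>y\<in>upper_adjacent P x. - theta (diagram P) (color P y) a) \<le> 1)"

definition LCB1 :: "('p, 'c) colored_poset \<Rightarrow> bool" where
  "LCB1 P \<longleftrightarrow> (\<forall>a\<in>colors (diagram P). \<forall>x. minimal_in_color P a x \<longrightarrow>
     finite (lower_adjacent P x) \<and>
     (\<Sum>y\<in>lower_adjacent P x. - theta (diagram P) (color P y) a) \<le> 1)"

definition minuscule :: "('p, 'c) colored_poset \<Rightarrow> bool" where
  "minuscule P \<longleftrightarrow> is_colored_poset P \<and> locally_finite P \<and>
     EC P \<and> NA P \<and> AC P \<and> ICE2 P \<and> UCB1 P \<and> LCB1 P"

definition is_chain :: "('p, 'c) colored_poset \<Rightarrow> bool" where
  "is_chain P \<longleftrightarrow> total_on (elements P) (le P)"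

definition colored_poset_isomorphic ::
    "('p, 'c) colored_poset \<Rightarrow> ('q, 'd) colored_poset \<Rightarrow> bool" where
  "colored_poset_isomorphic P Q \<longleftrightarrow> (\<exists>\<pi> \<gamma>.
     bij_betw \<pi> (elements P) (elements Q) \<and>
     (\<forall>x\<in>elements P. \<forall>y\<in>elements P. (x, y) \<in> le P \<longleftrightarrow> (\<pi> x, \<pi> y) \<in> le Q) \<and>
     bij_betw \<gamma> (colors (diagram P)) (colors (diagram Q)) \<and>
     (\<forall>a\<in>colors (diagram P). \<forall>b\<in>colors (diagram P).
        theta (diagram Q) (\<gamma> a) (\<gamma> b) = theta (diagram P) a b) \<and>
     (\<forall>x\<in>elements P. color Q (\<pi> x) = \<gamma> (color P x)))"

(* The simply laced path 1 - 2 - ... - n. *)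
definition type_A_diagram :: "nat \<Rightarrow> nat dynkin" where
  "type_A_diagram n = \<lparr>
     colors = {1..n},
     theta = (\<lambda>i j. if i = j then 2 else if i = Suc j \<or> j = Suc i then -1 else 0)\<rparr>"

(* The elements are 1, ..., n listed from top to bottom, hence the reversed order;
   the i-th element from the top has color i. *)
definition type_A_chain :: "nat \<Rightarrow> (nat, nat) colored_poset" where
  "type_A_chain n = \<lparr>
     elements = {1..n},
     le = {(i, j). i \<in> {1..n} \<and> j \<in> {1..n} \<and> j \<le> i},
     color = (\<lambda>i. i),
     diagram = type_A_diagram n\<rparr>"

definition type_A_standard :: "('p, 'c) colored_poset \<Rightarrow> bool" where
  "type_A_standard P \<longleftrightarrow> (\<exists>n\<ge>1. colored_poset_isomorphic P (type_A_chain n))"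

end

(* Number the chain from top to bottom. If a color repeated, take a repetition at positions i < j
   with j - i minimal and, among these, with i maximal. The colors along the window close up to a
   cycle of the Dynkin diagram, so position i + 1 has two lower elements of adjacent color,
   namely at i + 2 and j. By (LCB1) its color must then repeat further down, and (ICE2) forces the
   repetition to be at j + 1, contradicting the choice of i. Hence all colors are distinct, and
   (LCB1) allows each element at most one lower element of adjacent color, so that the
   diagram is a path. *)

theory Submission
  imports Defs
begin

lemma card_le_1_eq:
  assumes "finite A" "card A \<le> 1" "x \<in> A" "y \<in> A"
  shows "x = y"
  using assms card_le_Suc0_iff_eq by (metis One_nat_def)

text \<open>The combinatorial core, freed from posets: \<open>c i\<close> is the color of the
  \<open>i\<close>-th element from the top and \<open>R\<close> is adjacency of colors.
  \<open>next_adj\<close> and \<open>next_neq\<close> encode (NA), \<open>between\<close> encodes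
  (ICE2), and \<open>after\<close> encodes (LCB1).\<close>

lemma color_sequence_inj:
  fixes c :: "nat \<Rightarrow> 'c" and n :: nat
  assumes sym: "\<And>i j. i \<in> {1..n} \<Longrightarrow> j \<in> {1..n} \<Longrightarrow> R (c i) (c j) \<Longrightarrow> R (c j) (c i)"
    and next_adj: "\<And>i. 1 \<le> i \<Longrightarrow> Suc i \<le> n \<Longrightarrow> R (c (Suc i)) (c i)"
    and next_neq: "\<And>i. 1 \<le> i \<Longrightarrow> Suc i \<le> n \<Longrightarrow> c (Suc i) \<noteq> c i"
    and between: "\<And>i j. 1 \<le> i \<Longrightarrow> i < j \<Longrightarrow> j \<le> n \<Longrightarrow> c i = c j \<Longrightarrow>
        (\<And>l. i < l \<Longrightarrow> l < j \<Longrightarrow> c l \<noteq> c i) \<Longrightarrow> card {l\<in>{i<..<j}. R (c l) (c i)} = 2"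
    and after: "\<And>i. 1 \<le> i \<Longrightarrow> i \<le> n \<Longrightarrow> (\<And>l. i < l \<Longrightarrow> l \<le> n \<Longrightarrow> c l \<noteq> c i) \<Longrightarrow>
        card {l\<in>{i<..n}. R (c l) (c i)} \<le> 1"
  shows "inj_on c {1..n}"
proof (rule ccontr)
  define rep where "rep i d \<longleftrightarrow> 1 \<le> i \<and> 0 < d \<and> i + d \<le> n \<and> c i = c (i + d)" for i d
  assume "\<not> inj_on c {1..n}"
  then obtain i j where ij: "i \<in> {1..n}" "j \<in> {1..n}" "c i = c j" "i < j"
    by (metis inj_on_def linorder_neq_iff)
  then have "rep i (j - i)" by (auto simp: rep_def)
  then have ex: "\<exists>d i. rep i d" by blast
  define d where "d = (LEAST d. \<exists>i. rep i d)"
  have d: "\<exists>i. rep i d" unfolding d_def using ex by (rule LeastI_ex)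
  have d_min: "d \<le> e" if "rep k e" for k e
    unfolding d_def using that by (blast intro: Least_le)
  \<comment> \<open>A lowest window of the minimal length \<open>d\<close> exists because starting
    positions are bounded by \<open>n\<close>.\<close>
  have "\<exists>i. rep i d \<and> (\<forall>k. rep k d \<longrightarrow> k \<le> i)"
    using d by (elim exE, intro Nat.ex_has_greatest_nat[where b = n]) (auto simp: rep_def)
  then obtain i where i: "rep i d" and i_max: "\<And>k. rep k d \<Longrightarrow> k \<le> i" by blast
  have r: "1 \<le> i" "0 < d" "i + d \<le> n" "c i = c (i + d)"
    using i by (simp_all add: rep_def)
  have distinct: "c l \<noteq> c k" if "1 \<le> k" "k < l" "l < k + d" "l \<le> n" for k l
  proof
    assume "c l = c k"
    then have "rep k (l - k)" using that by (auto simp: rep_def)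
    from d_min[OF this] show False using that by auto
  qed
  have "c l \<noteq> c i" if "i < l" "l < i + d" for l
    using distinct[of i l] r that by simp
  \<comment> \<open>The window has \<open>d - 1\<close> inner positions and two of them are adjacent
    to \<open>c i\<close>, so \<open>d\<close> is at least 3. Hence \<open>i + 2\<close> and
    \<open>i + d\<close> are different positions below \<open>Suc i\<close>.\<close>
  then have "card {l\<in>{i<..<i+d}. R (c l) (c i)} = 2"
    using r by (intro between; (linarith | blast))
  moreover have "card {l\<in>{i<..<i+d}. R (c l) (c i)} \<le> card {i<..<i+d}"
    by (rule card_mono) auto
  ultimately have d3: "3 \<le> d" by auto
  have adj2: "R (c (i + 2)) (c (Suc i))"
    using next_adj[of "Suc i"] r d3 by auto
  \<comment> \<open>The cycle closes here: \<open>c (i + d)\<close> equals \<open>c i\<close>, which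
    is adjacent to \<open>c (Suc i)\<close>.\<close>
  have adjd: "R (c (i + d)) (c (Suc i))"
    using sym[OF _ _ next_adj[of i]] r d3 by auto
  have "\<exists>l. Suc i < l \<and> l \<le> n \<and> c l = c (Suc i)"
  proof (rule ccontr)
    assume "\<not> ?thesis"
    then have "card {l\<in>{Suc i<..n}. R (c l) (c (Suc i))} \<le> 1"
      using r d3 by (intro after) auto
    then have "i + 2 = i + d"
      using r d3 adj2 adjd by (intro card_le_1_eq[of "{l\<in>{Suc i<..n}. R (c l) (c (Suc i))}"]) auto
    then show False using d3 by simp
  qed
  define m where "m = (LEAST l. Suc i < l \<and> l \<le> n \<and> c l = c (Suc i))"
  have m: "Suc i < m" "m \<le> n" "c m = c (Suc i)"
    using LeastI_ex[OF \<open>\<exists>l. Suc i < l \<and> l \<le> n \<and> c l = c (Suc i)\<close>] unfolding m_def by auto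
  have m_min: "c l \<noteq> c (Suc i)" if "Suc i < l" "l < m" for l
    using not_less_Least[of l "\<lambda>l. Suc i < l \<and> l \<le> n \<and> c l = c (Suc i)"] that m
    unfolding m_def[symmetric] by auto
  \<comment> \<open>A shorter gap between \<open>Suc i\<close> and \<open>m\<close> would contradict
    the minimality of \<open>d\<close>.\<close>
  have "Suc i + d \<le> m"
    using distinct[of "Suc i" m] m by (meson Suc_leI not_less r le_SucI zero_less_Suc)
  let ?S = "{l\<in>{Suc i<..<m}. R (c l) (c (Suc i))}"
  have m1: "m - 1 \<in> {1..n}" using m by auto
  have "R (c m) (c (m - 1))" using next_adj[of "m - 1"] m by auto
  then have "R (c (m - 1)) (c (Suc i))"
    using sym[OF _ m1, of m] m by simp
  \<comment> \<open>The set \<open>?S\<close> has only two elements, so two of these three positions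
    coincide. Since \<open>i + 2 < i + d \<le> m - 1\<close>, it must be that
    \<open>m - 1 = i + d\<close>.\<close>
  then have "{i + 2, i + d, m - 1} \<subseteq> ?S"
    using \<open>Suc i + d \<le> m\<close> d3 adj2 adjd by auto
  then have "card {i + 2, i + d, m - 1} \<le> card ?S"
    by (intro card_mono) auto
  also have "card ?S = 2"
    using m m_min by (intro between) auto
  finally have "m = Suc i + d"
    using \<open>Suc i + d \<le> m\<close> d3 by (auto simp: card_insert_if split: if_splits)
  then have "rep (Suc i) d"
    using m r by (auto simp: rep_def)
  from i_max[OF this] show False by simp
qed

text \<open>Off the diagonal a simply laced \<open>theta\<close> takes only the values 0 and -1, so
  each summand is the indicator of adjacency. This turns the sums in (ICE2) and (LCB1) into the
  cardinalities used for color sequences.\<close>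

lemma sum_neg_theta_eq_card:
  assumes "dynkin_diagram G" "simply_laced G" "a \<in> colors G" "finite A"
    and "\<And>z. z \<in> A \<Longrightarrow> col z \<in> colors G \<and> col z \<noteq> a"
  shows "(\<Sum>z\<in>A. - theta G (col z) a) = int (card {z\<in>A. adjacent G (col z) a})"
proof -
  have "- theta G (col z) a = (if adjacent G (col z) a then 1 else 0)" if "z \<in> A" for z
  proof -
    have "theta G (col z) a \<in> {-1, 0, 2}" "theta G (col z) a \<le> 0"
      using assms that unfolding simply_laced_def dynkin_diagram_def by blast+
    then show ?thesis using assms(5)[OF that] by (auto simp: adjacent_def)
  qed
  then have "(\<Sum>z\<in>A. - theta G (col z) a) = (\<Sum>z\<in>A. if adjacent G (col z) a then 1 else 0)"
    by (rule sum.cong[OF refl])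
  also have "\<dots> = int (card {z\<in>A. adjacent G (col z) a})"
    using \<open>finite A\<close> by (simp add: sum.inter_filter[symmetric])
  finally show ?thesis .
qed

lemma adjacent_sym:
  assumes "dynkin_diagram G" "a \<in> colors G" "b \<in> colors G" "adjacent G a b"
  shows "adjacent G b a"
  using assms unfolding dynkin_diagram_def adjacent_def by (metis order_le_less)

text \<open>Each element is ranked by the number of elements weakly above it. The top element thus
  gets rank 1, ranks reverse the order, and the enumeration is the inverse of the rank
  function.\<close>

lemma finite_chain_enumeration:
  assumes "is_colored_poset P" "finite (elements P)" "is_chain P"
  obtains f where "bij_betw f {1..card (elements P)} (elements P)"
    and "\<And>i j. i \<in> {1..card (elements P)} \<Longrightarrow> j \<in> {1..card (elements P)} \<Longrightarrow>
      (f i, f j) \<in> le P \<longleftrightarrow> j \<le> i"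
proof -
  let ?E = "elements P" and ?n = "card (elements P)"
  define r where "r x = card {y\<in>?E. (x, y) \<in> le P}" for x
  have refl: "(x, x) \<in> le P" if "x \<in> ?E" for x
    using assms that by (auto simp: is_colored_poset_def partial_order_on_def preorder_on_def refl_on_def)
  have trans: "trans (le P)" and anti: "antisym (le P)"
    using assms by (auto simp: is_colored_poset_def partial_order_on_def preorder_on_def)
  have total: "(x, y) \<in> le P \<or> (y, x) \<in> le P" if "x \<in> ?E" "y \<in> ?E" for x y
    using assms(3) that refl by (cases "x = y") (auto simp: is_chain_def total_on_def)
  have less: "r y < r x" if "x \<in> ?E" "y \<in> ?E" "(x, y) \<in> le P" "x \<noteq> y" for x y
    unfolding r_def
  proof (rule psubset_card_mono)
    show "finite {y\<in>?E. (x, y) \<in> le P}" using assms(2) by simp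
    have "(y, x) \<notin> le P" using that anti by (auto dest: antisymD)
    then show "{z\<in>?E. (y, z) \<in> le P} \<subset> {y\<in>?E. (x, y) \<in> le P}"
      using that refl trans by (auto dest: transD)
  qed
  have le_iff: "(x, y) \<in> le P \<longleftrightarrow> r y \<le> r x" if "x \<in> ?E" "y \<in> ?E" for x y
    using less[of x y] less[of y x] that total refl by (metis leD less_le_not_le order_refl)
  have inj: "inj_on r ?E"
    using less total by (metis inj_onI less_irrefl)
  have "r ` ?E \<subseteq> {1..?n}"
  proof safe
    fix x assume "x \<in> ?E"
    then have "0 < r x" unfolding r_def using refl assms(2) by (auto simp: card_gt_0_iff)
    moreover have "r x \<le> ?n" unfolding r_def using assms(2) by (auto intro: card_mono)
    ultimately show "r x \<in> {1..?n}" by auto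
  qed
  \<comment> \<open>An injective image of \<open>?E\<close> inside a set of the same size fills
    it.\<close>
  then have "r ` ?E = {1..?n}"
    by (intro card_subset_eq) (auto simp: card_image[OF inj])
  then have bij: "bij_betw r ?E {1..?n}" using inj by (simp add: bij_betw_def)
  show ?thesis
  proof (rule that[of "inv_into ?E r"])
    show "bij_betw (inv_into ?E r) {1..?n} ?E" using bij by (rule bij_betw_inv_into)
    fix i j assume "i \<in> {1..?n}" "j \<in> {1..?n}"
    then show "(inv_into ?E r i, inv_into ?E r j) \<in> le P \<longleftrightarrow> j \<le> i"
      using le_iff bij by (metis bij_betw_imp_surj_on f_inv_into_f inv_into_into)
  qed
qed

theorem theorem4p6:
  fixes P :: "('p, 'c) colored_poset"
  assumes "minuscule P"
    and "finite (elements P)"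
    and "connected_poset P"
    and "simply_laced (diagram P)"
    and "is_chain P"
  shows "type_A_standard P"
proof -
  let ?E = "elements P" and ?G = "diagram P"
  define n where "n = card ?E"
  have P: "is_colored_poset P" "NA P" "ICE2 P" "LCB1 P"
    using assms(1) by (auto simp: minuscule_def)
  then have G: "dynkin_diagram ?G" and surj: "color P ` ?E = colors ?G"
    by (auto simp: is_colored_poset_def)
  obtain f where f: "bij_betw f {1..n} ?E"
    and f_le: "\<And>i j. i \<in> {1..n} \<Longrightarrow> j \<in> {1..n} \<Longrightarrow> (f i, f j) \<in> le P \<longleftrightarrow> j \<le> i"
    using finite_chain_enumeration[OF P(1) assms(2,5)] unfolding n_def by blast
  have f_inj: "inj_on f {1..n}" and f_img: "f ` {1..n} = ?E"
    using f by (auto simp: bij_betw_def)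
  have f_in: "f i \<in> ?E" if "i \<in> {1..n}" for i using that f_img by blast
  have f_lt: "lt P (f i) (f j) \<longleftrightarrow> j < i" if "i \<in> {1..n}" "j \<in> {1..n}" for i j
    using f_le[OF that] inj_on_eq_iff[OF f_inj that] by (auto simp: lt_def)
  \<comment> \<open>The endpoints are swapped because larger positions lie lower in the
    poset.\<close>
  have interval: "open_interval P (f j) (f i) = f ` {i<..<j}" if "i \<in> {1..n}" "j \<in> {1..n}" for i j
  proof -
    have "open_interval P (f j) (f i) = f ` {l\<in>{1..n}. lt P (f j) (f l) \<and> lt P (f l) (f i)}"
      unfolding open_interval_def f_img[symmetric] by auto
    also have "{l\<in>{1..n}. lt P (f j) (f l) \<and> lt P (f l) (f i)} = {i<..<j}"
      using f_lt that by auto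
    finally show ?thesis .
  qed
  define c where "c i = color P (f i)" for i
  have c_in: "c i \<in> colors ?G" if "i \<in> {1..n}" for i
    using f_in[OF that] surj by (auto simp: c_def)
  let ?R = "adjacent ?G"
  have R_sym: "?R (c j) (c i)" if "i \<in> {1..n}" "j \<in> {1..n}" "?R (c i) (c j)" for i j
    using adjacent_sym[OF G] c_in that by blast
  have next_adj: "?R (c (Suc i)) (c i)" if "1 \<le> i" "Suc i \<le> n" for i
  proof -
    have i: "i \<in> {1..n}" "Suc i \<in> {1..n}" using that by auto
    have "{i<..<Suc i} = {}" by auto
    then have "covers P (f i) (f (Suc i))"
      using f_lt interval i by (simp add: covers_def)
    then have "neighbors P (f (Suc i)) (f i)" by (simp add: neighbors_def)
    then show ?thesis using P(2) f_in i by (simp add: NA_def c_def)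
  qed
  have card_f: "card {z\<in>f ` A. ?R (color P z) a} = card {l\<in>A. ?R (c l) a}"
    if "A \<subseteq> {1..n}" for A a
  proof -
    have "{z\<in>f ` A. ?R (color P z) a} = f ` {l\<in>A. ?R (c l) a}" by (auto simp: c_def)
    moreover have "inj_on f {l\<in>A. ?R (c l) a}"
      using f_inj that by (auto intro: inj_on_subset)
    ultimately show ?thesis by (simp add: card_image)
  qed
  have between: "card {l\<in>{i<..<j}. ?R (c l) (c i)} = 2"
    if ij: "1 \<le> i" "i < j" "j \<le> n" "c i = c j" and no: "\<And>l. i < l \<Longrightarrow> l < j \<Longrightarrow> c l \<noteq> c i" for i j
  proof -
    have i: "i \<in> {1..n}" "j \<in> {1..n}" "{i<..<j} \<subseteq> {1..n}" using ij by auto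
    have "consecutive P (c i) (f j) (f i)"
      using i ij no f_in f_lt interval by (auto simp: consecutive_def color_class_def c_def)
    then have "(\<Sum>z\<in>open_interval P (f j) (f i). - theta ?G (color P z) (c i)) = 2"
      using P(3) c_in[OF i(1)] unfolding ICE2_def by blast
    then have "(\<Sum>z\<in>f ` {i<..<j}. - theta ?G (color P z) (c i)) = 2"
      by (simp only: interval[OF i(1,2)])
    moreover have "(\<Sum>z\<in>f ` {i<..<j}. - theta ?G (color P z) (c i)) =
        int (card {z\<in>f ` {i<..<j}. ?R (color P z) (c i)})"
      using i c_in no by (intro sum_neg_theta_eq_card[OF G assms(4)]) (auto simp: c_def)
    ultimately show ?thesis using card_f[OF i(3)] by simp
  qed
  have after: "card {l\<in>{i<..n}. ?R (c l) (c i)} \<le> 1"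
    if ij: "1 \<le> i" "i \<le> n" and no: "\<And>l. i < l \<Longrightarrow> l \<le> n \<Longrightarrow> c l \<noteq> c i" for i
  proof -
    have i: "i \<in> {1..n}" "{i<..n} \<subseteq> {1..n}" using ij by auto
    \<comment> \<open>Elements below \<open>f i\<close> are those at later positions, and none of
      them has its color.\<close>
    have "minimal_in_color P (c i) (f i)"
      unfolding minimal_in_color_def color_class_def f_img[symmetric]
      using i no f_lt by (auto simp: c_def)
    then have "(\<Sum>z\<in>lower_adjacent P (f i). - theta ?G (color P z) (c i)) \<le> 1"
      using P(4) c_in i by (auto simp: LCB1_def)
    moreover have low: "lower_adjacent P (f i) = {z\<in>f ` {i<..n}. ?R (color P z) (c i)}"
      unfolding lower_adjacent_def f_img[symmetric] using i f_lt by (auto simp: c_def)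
    moreover have "(\<Sum>z\<in>lower_adjacent P (f i). - theta ?G (color P z) (c i)) =
        int (card {z\<in>lower_adjacent P (f i). ?R (color P z) (c i)})"
      using i c_in unfolding low
      by (intro sum_neg_theta_eq_card[OF G assms(4)]) (auto simp: c_def adjacent_def)
    ultimately show ?thesis using card_f[OF i(2)] by simp
  qed
  have c_inj: "inj_on c {1..n}"
    by (rule color_sequence_inj[where R = ?R, OF R_sym next_adj _ between after])
       (use next_adj in \<open>auto simp: adjacent_def\<close>)
  have c_bij: "bij_betw c {1..n} (colors ?G)"
    using c_inj surj f_img by (auto simp: bij_betw_def c_def image_image[symmetric])
  \<comment> \<open>With all colors distinct, \<open>after\<close> applies at every position. Both
    \<open>j\<close> and \<open>Suc i\<close> lie in a set of size at most 1.\<close>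
  have adj_next: "j = Suc i" if "1 \<le> i" "i < j" "j \<le> n" "?R (c j) (c i)" for i j
  proof (rule card_le_1_eq)
    show "card {l\<in>{i<..n}. ?R (c l) (c i)} \<le> 1"
      using that inj_onD[OF c_inj] by (intro after) fastforce+
    show "j \<in> {l\<in>{i<..n}. ?R (c l) (c i)}" "Suc i \<in> {l\<in>{i<..n}. ?R (c l) (c i)}"
      using that next_adj[of i] by auto
  qed simp
  have theta: "theta ?G (c i) (c j) = theta (type_A_diagram n) i j"
    if ij: "i \<in> {1..n}" "j \<in> {1..n}" for i j
  proof (cases "i = j")
    case True
    then show ?thesis using G c_in ij by (simp add: dynkin_diagram_def type_A_diagram_def)
  next
    case False
    then have neq: "c i \<noteq> c j" using c_inj ij by (auto dest: inj_onD)
    have "?R (c i) (c j) \<longleftrightarrow> i = Suc j \<or> j = Suc i"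
    proof
      assume "?R (c i) (c j)"
      then show "i = Suc j \<or> j = Suc i"
        using adj_next[of i j] adj_next[of j i] R_sym[OF ij] ij False by (cases "i < j") simp_all
    next
      assume "i = Suc j \<or> j = Suc i"
      then show "?R (c i) (c j)" using next_adj[of i] next_adj[of j] R_sym[OF ij(2,1)] ij by auto
    qed
    \<comment> \<open>Only -1 and 0 remain, so adjacency determines the entry of
      \<open>theta\<close>.\<close>
    moreover have "theta ?G (c i) (c j) \<in> {-1, 0, 2}" "theta ?G (c i) (c j) \<le> 0"
      using G assms(4) c_in ij neq unfolding simply_laced_def dynkin_diagram_def by blast+
    ultimately show ?thesis using False neq by (auto simp: adjacent_def type_A_diagram_def)
  qed
  have "colored_poset_isomorphic P (type_A_chain n)"
    unfolding colored_poset_isomorphic_def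
  proof (intro exI conjI ballI)
    \<comment> \<open>Both maps return the position: \<open>?p\<close> that of an element,
      \<open>?g\<close> that of the unique element with a given color. They are compatible with the
      colorings because the model chain is colored by the identity.\<close>
    let ?p = "inv_into {1..n} f" and ?g = "inv_into {1..n} c"
    have p: "?p (f i) = i" and g: "?g (c i) = i" if "i \<in> {1..n}" for i
      using f_inj c_inj that by auto
    show "bij_betw ?p ?E (elements (type_A_chain n))"
      using bij_betw_inv_into[OF f] by (simp add: type_A_chain_def)
    show "bij_betw ?g (colors ?G) (colors (diagram (type_A_chain n)))"
      using bij_betw_inv_into[OF c_bij] by (simp add: type_A_chain_def type_A_diagram_def)
    show "(x, y) \<in> le P \<longleftrightarrow> (?p x, ?p y) \<in> le (type_A_chain n)" if "x \<in> ?E" "y \<in> ?E" for x y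
      using that p f_le unfolding f_img[symmetric] by (auto simp: type_A_chain_def)
    show "color (type_A_chain n) (?p x) = ?g (color P x)" if "x \<in> ?E" for x
      using that p g unfolding f_img[symmetric] by (auto simp: type_A_chain_def c_def)
    show "theta (diagram (type_A_chain n)) (?g a) (?g b) = theta ?G a b"
      if ab_in: "a \<in> colors ?G" "b \<in> colors ?G" for a b
    proof -
      obtain i j where ij: "i \<in> {1..n}" "j \<in> {1..n}" and ab: "a = c i" "b = c j"
        using ab_in unfolding bij_betw_imp_surj_on[OF c_bij, symmetric] by blast
      show ?thesis
        unfolding ab g[OF ij(1)] g[OF ij(2)] theta[OF ij] by (simp add: type_A_chain_def)
    qed
  qed
  moreover have "n \<ge> 1"
    using assms(2,3) by (simp add: n_def connected_poset_def Suc_le_eq card_gt_0_iff)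
  ultimately show ?thesis by (auto simp: type_A_standard_def)
qed

end
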